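(* Let $X$ be a locally compact $\sigma$-compact Hausdorff space and let $G$ be a nearly proper group of homeomorphisms of $X$ such that the orbit space $G\backslash X$ is a regular space. Then $X$ has a $G$-invariant proper open cover.
   Context: $G\backslash X$ denotes the orbit space with the quotient topology. Locally compact: every point has an open neighborhood whose closure is compact. $\sigma$-compact: a countable union of compact subsets. Regular means: for every point $x$ and every open neighborhood $U$ of $x$ there is an open neighborhood $V$ of $x$ with $\mathrm{cl}(V)\subset U$ (no further separation axiom is included). $G$ is nearly proper if for all compact subsets $A$ and $B$ of $X$, $\mathrm{cl}\big(\bigcup\{g(A):g\in G\text{ and }g(A)\cap B\neq\emptyset\}\big)$ is compact. An open cover $\mathcal{U}$ of $X$ is $G$-invariant if $g(U)\in\mathcal{U}$ for every $U\in\mathcal{U}$ and $g\in G$. For $A\subset X$, $\mathrm{Star}(A,\mathcal{U})=\bigcup\{U\in\mathcal{U}:A\cap U\ne\emptyset\}$. An open cover $\mathcal{U}$ is proper if $\mathrm{cl}(\mathrm{Star}(A,\mathcal{U}))$ is compact for every compact $A\subset X$. *)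

theory Defs
  imports "HOL-Analysis.Analysis" "HOL-Algebra.Bij"
begin

no_notation eq_closure_of (\<open>closure'_of\<index>\<close>)

text \<open>Elements of \<^term>\<open>BijGroup S\<close> are extensional (equal to \<^const>\<open>undefined\<close> off \<open>S\<close>), so two
  elements of \<open>G\<close> that agree on the space are equal, and the product is composition on the space.\<close>

definition homeomorphism_group :: "'a topology \<Rightarrow> ('a \<Rightarrow> 'a) set \<Rightarrow> bool" where
  "homeomorphism_group X G \<longleftrightarrow>
     subgroup G (BijGroup (topspace X)) \<and> (\<forall>g\<in>G. homeomorphic_map X X g)"

definition sigma_compact_space :: "'a topology \<Rightarrow> bool" where
  "sigma_compact_space X \<longleftrightarrow>
     (\<exists>\<K>. countable \<K> \<and> (\<forall>K\<in>\<K>. compactin X K) \<and> \<Union>\<K> = topspace X)"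

definition quotient_topology :: "'a topology \<Rightarrow> ('a \<Rightarrow> 'b) \<Rightarrow> 'b topology" where
  "quotient_topology X q =
     topology (\<lambda>W. W \<subseteq> q ` topspace X \<and> openin X {x \<in> topspace X. q x \<in> W})"

definition orbit_of :: "('a \<Rightarrow> 'a) set \<Rightarrow> 'a \<Rightarrow> 'a set" where
  "orbit_of G x = {g x |g. g \<in> G}"

definition orbit_space :: "('a \<Rightarrow> 'a) set \<Rightarrow> 'a topology \<Rightarrow> 'a set topology" where
  "orbit_space G X = quotient_topology X (orbit_of G)"

definition nearly_proper :: "'a topology \<Rightarrow> ('a \<Rightarrow> 'a) set \<Rightarrow> bool" where
  "nearly_proper X G \<longleftrightarrow>
     (\<forall>A B. compactin X A \<and> compactin X B \<longrightarrow>
        compactin X (X closure_of (\<Union>{g ` A |g. g \<in> G \<and> g ` A \<inter> B \<noteq> {}})))"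

definition open_cover :: "'a topology \<Rightarrow> 'a set set \<Rightarrow> bool" where
  "open_cover X \<U> \<longleftrightarrow> (\<forall>U\<in>\<U>. openin X U) \<and> \<Union>\<U> = topspace X"

definition invariant_cover :: "('a \<Rightarrow> 'a) set \<Rightarrow> 'a set set \<Rightarrow> bool" where
  "invariant_cover G \<U> \<longleftrightarrow> (\<forall>U\<in>\<U>. \<forall>g\<in>G. g ` U \<in> \<U>)"

definition Star :: "'a set \<Rightarrow> 'a set set \<Rightarrow> 'a set" where
  "Star A \<U> = \<Union>{U \<in> \<U>. A \<inter> U \<noteq> {}}"

definition proper_cover :: "'a topology \<Rightarrow> 'a set set \<Rightarrow> bool" where
  "proper_cover X \<U> \<longleftrightarrow> (\<forall>A. compactin X A \<longrightarrow> compactin X (X closure_of (Star A \<U>)))"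

lemma openin_quotient_topology:
  "openin (quotient_topology X q) W \<longleftrightarrow>
     W \<subseteq> q ` topspace X \<and> openin X {x \<in> topspace X. q x \<in> W}"
proof -
  have "istopology (\<lambda>W. W \<subseteq> q ` topspace X \<and> openin X {x \<in> topspace X. q x \<in> W})"
    unfolding istopology_def
  proof (intro conjI allI impI)
    fix S T
    assume S: "S \<subseteq> q ` topspace X \<and> openin X {x \<in> topspace X. q x \<in> S}"
      and T: "T \<subseteq> q ` topspace X \<and> openin X {x \<in> topspace X. q x \<in> T}"
    have "{x \<in> topspace X. q x \<in> S \<inter> T} = {x \<in> topspace X. q x \<in> S} \<inter> {x \<in> topspace X. q x \<in> T}"
      by blast
    with S T show "openin X {x \<in> topspace X. q x \<in> S \<inter> T}"
      by (simp only: openin_Int)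
    show "S \<inter> T \<subseteq> q ` topspace X" using S by blast
  next
    fix \<K>
    assume K: "\<forall>K\<in>\<K>. K \<subseteq> q ` topspace X \<and> openin X {x \<in> topspace X. q x \<in> K}"
    have "{x \<in> topspace X. q x \<in> \<Union>\<K>} = (\<Union>K\<in>\<K>. {x \<in> topspace X. q x \<in> K})"
      by blast
    with K show "openin X {x \<in> topspace X. q x \<in> \<Union>\<K>}"
      by (metis (no_types, lifting) openin_Union imageE)
    show "\<Union>\<K> \<subseteq> q ` topspace X" using K by blast
  qed
  then show ?thesis
    by (simp add: quotient_topology_def topology_inverse')
qed

lemma topspace_quotient_topology: "topspace (quotient_topology X q) = q ` topspace X"
proof
  show "topspace (quotient_topology X q) \<subseteq> q ` topspace X"
    using openin_topspace[of "quotient_topology X q"] unfolding openin_quotient_topology by (rule conjunct1)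
  have "{x \<in> topspace X. q x \<in> q ` topspace X} = topspace X" by blast
  then have "openin (quotient_topology X q) (q ` topspace X)"
    by (simp add: openin_quotient_topology)
  then show "q ` topspace X \<subseteq> topspace (quotient_topology X q)"
    by (rule openin_subset)
qed

lemma quotient_map_orbit_space: "quotient_map X (orbit_space G X) (orbit_of G)"
  unfolding quotient_map_def orbit_space_def topspace_quotient_topology
proof (intro conjI allI impI refl)
  fix U assume "U \<subseteq> orbit_of G ` topspace X"
  then show "openin X {x \<in> topspace X. orbit_of G x \<in> U} =
      openin (quotient_topology X (orbit_of G)) U"
    by (simp only: openin_quotient_topology simp_thms)
qed

text \<open>The library's \<^const>\<open>locally_compact_space\<close> and \<^const>\<open>regular_space\<close> agree with the
  formulations by closures of open neighbourhoods (the former on Hausdorff spaces).\<close>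

lemma locally_compact_space_closure_iff:
  assumes "Hausdorff_space X"
  shows "locally_compact_space X \<longleftrightarrow>
    (\<forall>x\<in>topspace X. \<exists>U. openin X U \<and> x \<in> U \<and> compactin X (X closure_of U))"
proof
  assume L: "locally_compact_space X"
  show "\<forall>x\<in>topspace X. \<exists>U. openin X U \<and> x \<in> U \<and> compactin X (X closure_of U)"
  proof
    fix x assume "x \<in> topspace X"
    with L obtain U K where UK: "openin X U" "compactin X K" "x \<in> U" "U \<subseteq> K"
      unfolding locally_compact_space_def by blast
    have "X closure_of U \<subseteq> K"
      using UK assms by (simp add: closure_of_minimal compactin_imp_closedin)
    then have "compactin X (X closure_of U)"
      using UK(2) closed_compactin closedin_closure_of by blast
    with UK show "\<exists>U. openin X U \<and> x \<in> U \<and> compactin X (X closure_of U)" by blast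
  qed
next
  assume R: "\<forall>x\<in>topspace X. \<exists>U. openin X U \<and> x \<in> U \<and> compactin X (X closure_of U)"
  show "locally_compact_space X"
    unfolding locally_compact_space_def
  proof
    fix x assume "x \<in> topspace X"
    with R obtain U where U: "openin X U" "x \<in> U" "compactin X (X closure_of U)" by auto
    moreover have "U \<subseteq> X closure_of U"
      using U(1) by (intro closure_of_subset openin_subset)
    ultimately show "\<exists>U K. openin X U \<and> compactin X K \<and> x \<in> U \<and> U \<subseteq> K"
      by (intro exI[of _ U] exI[of _ "X closure_of U"] conjI)
  qed
qed

lemma regular_space_closure_iff:
  "regular_space X \<longleftrightarrow>
    (\<forall>x U. openin X U \<and> x \<in> U \<longrightarrow> (\<exists>V. openin X V \<and> x \<in> V \<and> X closure_of V \<subseteq> U))"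
  (is "_ \<longleftrightarrow> ?R")
proof -
  let ?L = "\<forall>W x. openin X W \<and> x \<in> W \<longrightarrow>
      (\<exists>U V. openin X U \<and> closedin X V \<and> x \<in> U \<and> U \<subseteq> V \<and> V \<subseteq> W)"
  have "regular_space X \<longleftrightarrow> ?L"
    by (rule trans[OF neighbourhood_base_of_closedin[symmetric] neighbourhood_base_of])
  also have "?L \<longleftrightarrow> ?R"
  proof (intro iffI allI impI)
    fix x U
    assume L: ?L and xU: "openin X U \<and> x \<in> U"
    obtain V C where VC: "openin X V" "closedin X C" "x \<in> V" "V \<subseteq> C" "C \<subseteq> U"
      using L[rule_format, OF xU] by (elim exE conjE)
    have "X closure_of V \<subseteq> C"
      using VC(4,2) by (rule closure_of_minimal)
    then have "X closure_of V \<subseteq> U" using VC(5) by (rule order_trans)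
    with VC(1,3) show "\<exists>V. openin X V \<and> x \<in> V \<and> X closure_of V \<subseteq> U"
      by (intro exI[of _ V] conjI)
  next
    fix W x
    assume R: ?R and xW: "openin X W \<and> x \<in> W"
    obtain V where V: "openin X V" "x \<in> V" "X closure_of V \<subseteq> W"
      using R[rule_format, OF xW] by (elim exE conjE)
    moreover have "V \<subseteq> X closure_of V"
      using V(1) by (intro closure_of_subset openin_subset)
    ultimately show "\<exists>U V. openin X U \<and> closedin X V \<and> x \<in> U \<and> U \<subseteq> V \<and> V \<subseteq> W"
      by (intro exI[of _ V] exI[of _ "X closure_of V"] conjI closedin_closure_of)
  qed
  finally show ?thesis .
qed

end

theory Submission
  imports Defs
begin

text \<open>Since the orbit space is regular and Lindelof, it has a countable open cover by sets
  \<open>W n\<close>, each inside the image of a relatively compact open set \<open>V n\<close>, such that every compact set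
  meets only finitely many of them. The translates of \<open>V n \<inter> \<pi>\<^sup>-\<^sup>1(W n)\<close> form an invariant cover,
  and the star of a compact set lies in a finite union of the sets that near properness makes
  relatively compact.\<close>

section \<open>Group elements as maps of the space\<close>

lemma homeomorphism_group_identity:
  assumes "homeomorphism_group X G"
  obtains e where "e \<in> G" "\<And>x. x \<in> topspace X \<Longrightarrow> e x = x"
proof
  have "\<one>\<^bsub>BijGroup (topspace X)\<^esub> \<in> G"
    using assms by (simp add: homeomorphism_group_def subgroup.one_closed)
  then show "(\<lambda>x\<in>topspace X. x) \<in> G" by (simp add: BijGroup_def)
qed simp

lemma homeomorphism_group_Bij:
  assumes "homeomorphism_group X G" "g \<in> G"
  shows "g \<in> Bij (topspace X)"
  using assms subgroup.subset[of G "BijGroup (topspace X)"]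
  by (auto simp: homeomorphism_group_def BijGroup_def)

lemma homeomorphism_group_compose:
  assumes "homeomorphism_group X G" "g \<in> G" "h \<in> G"
  shows "compose (topspace X) g h \<in> G"
proof -
  have "g \<otimes>\<^bsub>BijGroup (topspace X)\<^esub> h \<in> G"
    using assms by (simp add: homeomorphism_group_def subgroup.m_closed)
  then show ?thesis
    using assms by (simp add: BijGroup_def homeomorphism_group_Bij[OF assms(1)])
qed

text \<open>The inverse in \<open>BijGroup\<close> is \<open>inv_into\<close> restricted to the
  space, so it undoes \<open>g\<close> at points of the space.\<close>

lemma homeomorphism_group_inverse:
  assumes "homeomorphism_group X G" "g \<in> G"
  obtains h where "h \<in> G" "\<And>x. x \<in> topspace X \<Longrightarrow> h (g x) = x"
proof
  have B: "g \<in> Bij (topspace X)" using assms by (rule homeomorphism_group_Bij)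
  have "inv\<^bsub>BijGroup (topspace X)\<^esub> g \<in> G"
    using assms by (simp add: homeomorphism_group_def subgroup.m_inv_closed)
  then show "(\<lambda>x\<in>topspace X. inv_into (topspace X) g x) \<in> G"
    by (simp add: inv_BijGroup B)
  show "(\<lambda>x\<in>topspace X. inv_into (topspace X) g x) (g x) = x" if "x \<in> topspace X" for x
    using B that by (auto simp: Bij_def bij_betw_def)
qed

lemma homeomorphism_group_in_topspace:
  assumes "homeomorphism_group X G" "g \<in> G" "x \<in> topspace X"
  shows "g x \<in> topspace X"
  using homeomorphism_group_Bij[OF assms(1,2)] assms(3) by (auto simp: Bij_def bij_betw_def)

lemma homeomorphism_group_openin_image:
  assumes "homeomorphism_group X G" "g \<in> G" "openin X U"
  shows "openin X (g ` U)"
  using assms homeomorphic_map_openness_eq[of X X g U] by (simp add: homeomorphism_group_def)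

section \<open>Orbits and the orbit map\<close>

lemma orbit_of_self:
  assumes "homeomorphism_group X G" "x \<in> topspace X"
  shows "x \<in> orbit_of G x"
  using homeomorphism_group_identity[OF assms(1)] assms(2) unfolding orbit_of_def
  by (metis (mono_tags, lifting) mem_Collect_eq)

text \<open>Composing with \<open>g\<close> on the right gives one inclusion, composing with its
  inverse the other.\<close>

lemma orbit_of_image:
  assumes G: "homeomorphism_group X G" and g: "g \<in> G" and x: "x \<in> topspace X"
  shows "orbit_of G (g x) = orbit_of G x"
proof
  show "orbit_of G (g x) \<subseteq> orbit_of G x"
  proof
    fix y assume "y \<in> orbit_of G (g x)"
    then obtain h where "h \<in> G" "y = h (g x)" by (auto simp: orbit_of_def)
    then have "compose (topspace X) h g \<in> G" "y = compose (topspace X) h g x"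
      using homeomorphism_group_compose[OF G _ g] x by (auto simp: compose_def)
    then show "y \<in> orbit_of G x" by (auto simp: orbit_of_def)
  qed
  obtain k where k: "k \<in> G" "\<And>x. x \<in> topspace X \<Longrightarrow> k (g x) = x"
    using homeomorphism_group_inverse[OF G g] by blast
  show "orbit_of G x \<subseteq> orbit_of G (g x)"
  proof
    fix y assume "y \<in> orbit_of G x"
    then obtain h where "h \<in> G" "y = h x" by (auto simp: orbit_of_def)
    then have "compose (topspace X) h k \<in> G" "y = compose (topspace X) h k (g x)"
      using homeomorphism_group_compose[OF G _ k(1)] x k(2)
        homeomorphism_group_in_topspace[OF G g x] by (auto simp: compose_def)
    then show "y \<in> orbit_of G (g x)" by (auto simp: orbit_of_def)
  qed
qed

lemma orbit_of_eqD:
  assumes "homeomorphism_group X G" "x \<in> topspace X" "orbit_of G x = orbit_of G y"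
  obtains g where "g \<in> G" "x = g y"
  using orbit_of_self[OF assms(1,2)] assms(3) by (auto simp: orbit_of_def)

text \<open>The saturation of an open set is the union of its translates, each of which is open
  because group elements are homeomorphisms.\<close>

lemma open_map_orbit_of:
  assumes G: "homeomorphism_group X G"
  shows "open_map X (orbit_space G X) (orbit_of G)"
  unfolding open_map_def
proof (intro allI impI)
  fix U assume U: "openin X U"
  have UX: "U \<subseteq> topspace X" using U by (rule openin_subset)
  have "{x \<in> topspace X. orbit_of G x \<in> orbit_of G ` U} = (\<Union>g\<in>G. g ` U)"
  proof (intro equalityI subsetI)
    fix x assume "x \<in> {x \<in> topspace X. orbit_of G x \<in> orbit_of G ` U}"
    then obtain u where u: "x \<in> topspace X" "u \<in> U" "orbit_of G x = orbit_of G u" by blast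
    obtain g where "g \<in> G" "x = g u" using orbit_of_eqD[OF G u(1,3)] .
    with u(2) show "x \<in> (\<Union>g\<in>G. g ` U)" by blast
  next
    fix x assume "x \<in> (\<Union>g\<in>G. g ` U)"
    then obtain g u where gu: "g \<in> G" "u \<in> U" "x = g u" by blast
    then have "x \<in> topspace X" "orbit_of G x = orbit_of G u"
      using UX orbit_of_image[OF G gu(1)] homeomorphism_group_in_topspace[OF G gu(1)] by auto
    with gu(2) show "x \<in> {x \<in> topspace X. orbit_of G x \<in> orbit_of G ` U}" by simp
  qed
  moreover have "openin X (\<Union>g\<in>G. g ` U)"
    using homeomorphism_group_openin_image[OF G _ U] by (intro openin_Union) auto
  ultimately show "openin (orbit_space G X) (orbit_of G ` U)"
    unfolding orbit_space_def openin_quotient_topology using image_mono[OF UX] by simp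
qed

section \<open>Lindelof spaces and refinements finite on compact sets\<close>

text \<open>Each compact piece is Lindelof, and a countable union of Lindelof subspaces is again
  Lindelof. The property then passes to the orbit space along the quotient map.\<close>

lemma sigma_compact_imp_Lindelof_space:
  assumes "sigma_compact_space X"
  shows "Lindelof_space X"
proof -
  obtain \<K> where K: "countable \<K>" "\<And>K. K \<in> \<K> \<Longrightarrow> compactin X K" "\<Union>\<K> = topspace X"
    using assms by (auto simp: sigma_compact_space_def)
  have "Lindelof_space (subtopology X (\<Union>\<K>))"
    using K(1) by (rule Lindelof_space_Union)
      (intro compact_imp_Lindelof_space compact_space_subtopology K(2))
  then show ?thesis by (simp add: K(3))
qed

text \<open>Subtracting from each set of a countable cover the closed cores of its predecessors yields a
  cover that is still open and locally finite along the interiors of the cores.\<close>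

lemma Lindelof_regular_finite_on_compact_refinement:
  assumes L: "Lindelof_space Y" and R: "regular_space Y"
    and P: "\<And>y. y \<in> topspace Y \<Longrightarrow> openin Y (P y) \<and> y \<in> P y"
  obtains S W where "S \<subseteq> topspace Y" "\<And>y. y \<in> S \<Longrightarrow> openin Y (W y)"
    "\<And>y. y \<in> S \<Longrightarrow> W y \<subseteq> P y" "(\<Union>y\<in>S. W y) = topspace Y"
    "\<And>A. compactin Y A \<Longrightarrow> finite {y \<in> S. W y \<inter> A \<noteq> {}}"
proof -
  \<comment> \<open>Regularity supplies the cores: their interiors \<open>V y\<close> still cover,
    while their closures stay inside \<open>P y\<close>.\<close>
  have "\<exists>V. openin Y V \<and> y \<in> V \<and> Y closure_of V \<subseteq> P y" if "y \<in> topspace Y" for y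
    using R P[OF that] unfolding regular_space_closure_iff by blast
  then obtain V where V: "\<And>y. y \<in> topspace Y \<Longrightarrow> openin Y (V y)"
    "\<And>y. y \<in> topspace Y \<Longrightarrow> y \<in> V y" "\<And>y. y \<in> topspace Y \<Longrightarrow> Y closure_of V y \<subseteq> P y"
    by metis
  have "(\<forall>U\<in>V ` topspace Y. openin Y U) \<and> \<Union>(V ` topspace Y) = topspace Y"
    using V(1,2) openin_subset by blast
  then obtain \<V> where \<V>: "countable \<V>" "\<V> \<subseteq> V ` topspace Y" "\<Union>\<V> = topspace Y"
    using L unfolding Lindelof_space_def by meson
  then obtain S where S: "countable S" "S \<subseteq> topspace Y" "\<V> = V ` S"
    by (metis countable_subset_image)
  \<comment> \<open>An injective numbering of the countable set \<open>S\<close>, so that only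
    finitely many indices precede a given one.\<close>
  define i where "i = to_nat_on S"
  have i: "inj_on i S" unfolding i_def using S(1) by (rule inj_on_to_nat_on)
  have fin: "finite {y \<in> S. i y \<le> n}" for n
  proof (rule finite_imageD[of i])
    show "finite (i ` {y \<in> S. i y \<le> n})" by (rule finite_subset[of _ "{..n}"]) auto
    show "inj_on i {y \<in> S. i y \<le> n}" using i by (rule inj_on_subset) auto
  qed
  \<comment> \<open>The strict inequality keeps the core of \<open>y\<close> itself; only finitely
    many closed sets are removed, so the rest is open.\<close>
  define W where "W y = P y - (\<Union>z\<in>{z \<in> S. i z < i y}. Y closure_of V z)" for y
  show ?thesis
  proof
    show "S \<subseteq> topspace Y" by (fact S(2))
    show "openin Y (W y)" if "y \<in> S" for y
    proof -
      have "finite {z \<in> S. i z < i y}" by (rule finite_subset[OF _ fin[of "i y"]]) auto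
      then have "closedin Y (\<Union>z\<in>{z \<in> S. i z < i y}. Y closure_of V z)"
        by (intro closedin_Union) auto
      then show ?thesis
        unfolding W_def using P S(2) that by (intro openin_diff) auto
    qed
    show "W y \<subseteq> P y" for y by (auto simp: W_def)
    show "(\<Union>y\<in>S. W y) = topspace Y"
    proof
      show "(\<Union>y\<in>S. W y) \<subseteq> topspace Y"
        using P S(2) openin_subset unfolding W_def by blast
      show "topspace Y \<subseteq> (\<Union>y\<in>S. W y)"
      proof
        fix x assume x: "x \<in> topspace Y"
        then obtain z where z: "z \<in> S" "x \<in> V z" using S(3) \<V>(3) by blast
        have "x \<in> P z"
          using z S(2) V(1,3) closure_of_subset[of "V z" Y] openin_subset by blast
        \<comment> \<open>The least index is taken among the sets \<open>P y\<close> containing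
          \<open>x\<close>, not among the cores. Earlier cores lie in earlier sets
          \<open>P w\<close>, which miss \<open>x\<close>, so \<open>x\<close> survives the
          subtraction.\<close>
        then obtain y where y: "y \<in> S" "x \<in> P y" "\<And>w. w \<in> S \<Longrightarrow> x \<in> P w \<Longrightarrow> i y \<le> i w"
          using ex_has_least_nat[of "\<lambda>y. y \<in> S \<and> x \<in> P y" z i] z(1) by blast
        have "x \<notin> Y closure_of V w" if "w \<in> S" "i w < i y" for w
        proof
          assume "x \<in> Y closure_of V w"
          then have "x \<in> P w" using V(3)[of w] S(2) \<open>w \<in> S\<close> by blast
          with that y(3) show False by (meson leD)
        qed
        then have "x \<in> W y" unfolding W_def using y(2) by blast
        with y(1) show "x \<in> (\<Union>y\<in>S. W y)" by blast
      qed
    qed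
    fix A assume A: "compactin Y A"
    then have "A \<subseteq> \<Union>\<V>" using \<V>(3) compactin_subset_topspace by blast
    moreover have "openin Y U" if "U \<in> \<V>" for U using that \<V>(2) V(1) by blast
    ultimately obtain \<F> where F: "finite \<F>" "\<F> \<subseteq> V ` S" "A \<subseteq> \<Union>\<F>"
      using A S(3) unfolding compactin_def by metis
    then obtain T where T: "finite T" "T \<subseteq> S" "\<F> = V ` T" by (metis finite_subset_image)
    \<comment> \<open>Finitely many \<open>V z\<close> cover \<open>A\<close>, and
      \<open>W y\<close> is disjoint from \<open>V z\<close> as soon as \<open>i z < i y\<close>.
      Hence a \<open>W y\<close> that meets \<open>A\<close> has index at most that of some
      \<open>z\<close> in \<open>T\<close>.\<close>
    have "{y \<in> S. W y \<inter> A \<noteq> {}} \<subseteq> (\<Union>z\<in>T. {y \<in> S. i y \<le> i z})"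
    proof
      fix y assume "y \<in> {y \<in> S. W y \<inter> A \<noteq> {}}"
      then obtain a where a: "y \<in> S" "a \<in> W y" "a \<in> A" by blast
      then obtain z where z: "z \<in> T" "a \<in> V z" using F(3) T(3) by blast
      then have "a \<in> Y closure_of V z"
        using T(2) S(2) V(1) closure_of_subset[of "V z" Y] openin_subset by blast
      then have "i y \<le> i z" using a(2) z(1) T(2) unfolding W_def by force
      with z(1) a(1) show "y \<in> (\<Union>z\<in>T. {y \<in> S. i y \<le> i z})" by blast
    qed
    then show "finite {y \<in> S. W y \<inter> A \<noteq> {}}"
      using T(1) fin by (rule finite_subset[OF _ finite_UN_I])
  qed
qed

section \<open>Construction of the invariant proper cover\<close>

theorem lemma5p3:
  fixes X :: "'a topology" and G :: "('a \<Rightarrow> 'a) set"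
  assumes "locally_compact_space X"
    and "sigma_compact_space X"
    and "Hausdorff_space X"
    and "homeomorphism_group X G"
    and "nearly_proper X G"
    and "regular_space (orbit_space G X)"
  shows "\<exists>\<U>. open_cover X \<U> \<and> invariant_cover G \<U> \<and> proper_cover X \<U>"
proof -
  note G = \<open>homeomorphism_group X G\<close>
  let ?Y = "orbit_space G X" and ?q = "orbit_of G"
  have q: "quotient_map X ?Y ?q" by (rule quotient_map_orbit_space)
  have cont: "continuous_map X ?Y ?q" using q by (rule quotient_imp_continuous_map)
  have surj: "?q ` topspace X = topspace ?Y" using q by (rule quotient_imp_surjective_map)
  have "\<exists>V. openin X V \<and> compactin X (X closure_of V) \<and> y \<in> ?q ` V" if "y \<in> topspace ?Y" for y
  proof -
    obtain x where x: "x \<in> topspace X" "y = ?q x" using \<open>y \<in> topspace ?Y\<close> unfolding surj[symmetric] by (rule imageE)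
    obtain U where "openin X U" "x \<in> U" "compactin X (X closure_of U)"
      using assms(1) x(1) unfolding locally_compact_space_closure_iff[OF assms(3)] by meson
    then show ?thesis unfolding x(2) by (intro exI[of _ U] conjI imageI)
  qed
  then obtain V where V: "\<And>y. y \<in> topspace ?Y \<Longrightarrow> openin X (V y)"
    "\<And>y. y \<in> topspace ?Y \<Longrightarrow> compactin X (X closure_of V y)"
    "\<And>y. y \<in> topspace ?Y \<Longrightarrow> y \<in> ?q ` V y"
    by metis
  have L: "Lindelof_space ?Y"
    using q sigma_compact_imp_Lindelof_space[OF assms(2)] by (rule Lindelof_space_quotient_map_image)
  \<comment> \<open>The images of the relatively compact sets \<open>V y\<close> form the cover of
    the orbit space to be refined.\<close>
  have P: "openin ?Y (?q ` V y) \<and> y \<in> ?q ` V y" if "y \<in> topspace ?Y" for y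
    using V that open_map_orbit_of[OF G] by (auto simp: open_map_def)
  obtain S W where S: "S \<subseteq> topspace ?Y" and W: "\<And>y. y \<in> S \<Longrightarrow> openin ?Y (W y)"
    "\<And>y. y \<in> S \<Longrightarrow> W y \<subseteq> ?q ` V y" "(\<Union>y\<in>S. W y) = topspace ?Y"
    "\<And>A. compactin ?Y A \<Longrightarrow> finite {y \<in> S. W y \<inter> A \<noteq> {}}"
    by (rule Lindelof_regular_finite_on_compact_refinement[OF L assms(6) P]) (assumption, rule that)
  \<comment> \<open>\<open>V y\<close> is relatively compact and \<open>W y\<close> controls which
    orbits occur. For \<open>y\<close> in \<open>S\<close>, the set \<open>U y\<close> maps onto
    \<open>W y\<close>, since \<open>W y\<close> lies in the image of \<open>V y\<close>; so the
    translates of the \<open>U y\<close> cover \<open>X\<close>.\<close>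
  define U where "U y = V y \<inter> {x \<in> topspace X. ?q x \<in> W y}" for y
  define \<U> where "\<U> = {g ` U y |g y. g \<in> G \<and> y \<in> S}"
  have U: "openin X (U y)" if "y \<in> S" for y
    unfolding U_def using V(1) S W(1) that cont
    by (intro openin_Int openin_continuous_map_preimage) auto
  have "open_cover X \<U>"
    unfolding open_cover_def
  proof (intro conjI ballI equalityI subsetI)
    show "openin X A" if "A \<in> \<U>" for A
      using that homeomorphism_group_openin_image[OF G _ U] unfolding \<U>_def by blast
    then show "x \<in> topspace X" if "x \<in> \<Union>\<U>" for x
      using that openin_subset by blast
    fix x assume x: "x \<in> topspace X"
    then obtain y where y: "y \<in> S" "?q x \<in> W y" using W(3) surj by blast
    then obtain v where v: "v \<in> V y" "?q x = ?q v" using W(2) by blast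
    then obtain g where "g \<in> G" "x = g v" using orbit_of_eqD[OF G x] by blast
    moreover have "v \<in> U y"
      using v y S V(1) openin_subset[of X "V y"] by (auto simp: U_def)
    ultimately show "x \<in> \<Union>\<U>" using y(1) unfolding \<U>_def by blast
  qed
  moreover have "invariant_cover G \<U>"
    unfolding invariant_cover_def
  proof (intro ballI)
    fix A g assume "A \<in> \<U>" and g: "g \<in> G"
    then obtain h y where h: "A = h ` U y" "h \<in> G" "y \<in> S" unfolding \<U>_def by blast
    \<comment> \<open>\<open>compose\<close> agrees with ordinary composition on the space, which
      contains \<open>U y\<close>.\<close>
    have "g ` A = compose (topspace X) g h ` U y"
      unfolding h(1) image_image by (rule image_cong) (auto simp: U_def compose_def)
    then show "g ` A \<in> \<U>"
      using homeomorphism_group_compose[OF G g h(2)] h(3) unfolding \<U>_def by blast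
  qed
  moreover have "proper_cover X \<U>"
    unfolding proper_cover_def
  proof (intro allI impI)
    fix A assume A: "compactin X A"
    define F where "F = {y \<in> S. W y \<inter> ?q ` A \<noteq> {}}"
    \<comment> \<open>This is the set from near properness for the pair of compact sets
      \<open>X closure_of V y\<close> and \<open>A\<close>.\<close>
    define N where "N y = X closure_of (\<Union>{g ` (X closure_of V y) |g. g \<in> G \<and> g ` (X closure_of V y) \<inter> A \<noteq> {}})"
      for y
    have F: "finite F"
      unfolding F_def using W(4) image_compactin[OF A cont] by blast
    have N: "compactin X (N y)" if "y \<in> S" for y
      using assms(5) V(2) A S that unfolding nearly_proper_def N_def by blast
    \<comment> \<open>If \<open>g\<close> sends a point \<open>a\<close> of \<open>U y\<close> into
      \<open>A\<close>, then \<open>g a\<close> has the same orbit as \<open>a\<close>, so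
      \<open>W y\<close> meets the compact image of \<open>A\<close>, which leaves finitely many
      \<open>y\<close>. The translate \<open>g\<close> U y\<open>lies in\<close>N
      y\<open>, because\<close>g \<open>(X closure_of V y)\<close> also meets
      \<open>A\<close>.\<close>
    have "Star A \<U> \<subseteq> (\<Union>y\<in>F. N y)"
    proof
      fix x assume "x \<in> Star A \<U>"
      then obtain g y a where g: "g \<in> G" "y \<in> S" "x \<in> g ` U y" "a \<in> U y" "g a \<in> A"
        unfolding Star_def \<U>_def by blast
      have "?q (g a) \<in> W y"
        using g(4) orbit_of_image[OF G g(1)] by (auto simp: U_def)
      then have yF: "y \<in> F" using g unfolding F_def by blast
      have UV: "U y \<subseteq> X closure_of V y"
        using closure_of_subset[OF openin_subset[OF V(1)]] g(2) S by (auto simp: U_def)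
      let ?M = "\<Union>{g ` (X closure_of V y) |g. g \<in> G \<and> g ` (X closure_of V y) \<inter> A \<noteq> {}}"
      have "?M \<subseteq> topspace X"
        using homeomorphism_group_in_topspace[OF G] closure_of_subset_topspace[of X "V y"] by blast
      then have "?M \<subseteq> N y" unfolding N_def by (rule closure_of_subset)
      moreover have "x \<in> ?M" using g UV by blast
      ultimately show "x \<in> (\<Union>y\<in>F. N y)" using yF by blast
    qed
    moreover have K: "compactin X (\<Union>y\<in>F. N y)"
      using F N by (intro compactin_Union) (auto simp: F_def)
    \<comment> \<open>In a Hausdorff space the finite union of compact sets is closed, so it
      contains the closure of the star as well.\<close>
    ultimately have "X closure_of Star A \<U> \<subseteq> (\<Union>y\<in>F. N y)"
      by (intro closure_of_minimal compactin_imp_closedin[OF assms(3)])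
    then show "compactin X (X closure_of Star A \<U>)"
      using K closed_compactin closedin_closure_of by blast
  qed
  ultimately show ?thesis by blast
qed

end
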